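(* Let $w=(w(n))_{n\in\mathbb{N}}$ be a nonnegative weight sequence and $0<p<\infty$. The sequence Lorentz space $\gamma_{p,w}$ is order continuous if and only if $W(\infty)=\infty$.
   Context: $\mathbb{N}$ is the set of positive integers and $\ell^0$ is the set of all real sequences. For $x\in\ell^0$ put $d_x(\lambda)=\operatorname{card}\{k\in\mathbb{N}:|x(k)|>\lambda\}$ for $\lambda\ge 0$, $x^*(n)=\inf\{\lambda\ge 0: d_x(\lambda)\le n-1\}$ (decreasing rearrangement) and $x^{**}(n)=\frac1n\sum_{i=1}^n x^*(i)$ for $n\in\mathbb{N}$. Weight sequences: for the given $0<p<\infty$, a nonnegative weight sequence is a sequence $w=(w(n))_{n\in\mathbb{N}}$ of nonnegative reals, with $w(n)>0$ for at least one $n$, such that $W_p(n)=n^p\sum_{i=n+1}^\infty \frac{w(i)}{i^p}<\infty$ for every $n\in\mathbb{N}$. Put $W(n)=\sum_{i=1}^n w(i)$ and $W(\infty)=\sum_{i=1}^\infty w(i)\in(0,\infty]$. The sequence Lorentz space $\gamma_{p,w}$ is the space of all $x\in\ell^0$ with $\|x\|_{\gamma_{p,w}}=\left(\sum_{n=1}^\infty (x^{**}(n))^p w(n)\right)^{1/p}<\infty$; it is a quasi-Banach space under this quasi-norm. A quasi-Banach sequence space $E$ is order continuous if for every $x\in E$ and every sequence $(x_m)$ of nonnegative elements of $E$ with $x_m\le|x|$ for all $m$ and $x_m\to0$ pointwise, one has $\|x_m\|_E\to0$. *)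

theory Defs
  imports "HOL-Analysis.Analysis"
begin

text \<open>
  Sequences indexed by the positive integers are functions on \<open>nat\<close> of which only the values at
  \<open>n \<ge> 1\<close> matter. Elements of \<open>\<ell>\<^sup>0\<close> are normalised to vanish at the dummy index \<open>0\<close>, so that each
  real sequence is represented exactly once. Quantities that may be infinite (rearrangements of
  unbounded sequences, sums of nonnegative series, quasi-norms) take values in \<open>ennreal\<close>.
\<close>

definition ell0 :: "(nat \<Rightarrow> real) set" where
  "ell0 = {x. x 0 = 0}"

definition distr :: "(nat \<Rightarrow> real) \<Rightarrow> real \<Rightarrow> ennreal" where
  "distr x l = emeasure (count_space {1..}) {k \<in> {1..}. \<bar>x k\<bar> > l}"

text \<open>The infimum of the empty set is \<open>\<infinity>\<close>; it occurs exactly when \<open>x\<close> is unbounded.\<close>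

definition rearr :: "(nat \<Rightarrow> real) \<Rightarrow> nat \<Rightarrow> ennreal" where
  "rearr x n = Inf {ennreal l | l. 0 \<le> l \<and> distr x l \<le> of_nat (n - 1)}"

definition max_rearr :: "(nat \<Rightarrow> real) \<Rightarrow> nat \<Rightarrow> ennreal" where
  "max_rearr x n = (\<Sum>i=1..n. rearr x i) / of_nat n"

text \<open>Real powers on \<open>[0,\<infinity>]\<close>, meant for positive exponents only: \<open>\<infinity>\<^sup>a = \<infinity>\<close> and \<open>0\<^sup>a = 0\<close>.\<close>

definition epowr :: "ennreal \<Rightarrow> real \<Rightarrow> ennreal" where
  "epowr t a = (if t = \<infinity> then \<infinity> else ennreal (enn2real t powr a))"

definition Wp :: "real \<Rightarrow> (nat \<Rightarrow> real) \<Rightarrow> nat \<Rightarrow> ennreal" where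
  "Wp p w n = ennreal (real n powr p) *
     (\<Sum>i. ennreal (w (n + 1 + i) / real (n + 1 + i) powr p))"

definition W_inf :: "(nat \<Rightarrow> real) \<Rightarrow> ennreal" where
  "W_inf w = (\<Sum>i. ennreal (w (i + 1)))"

definition nonneg_weight :: "real \<Rightarrow> (nat \<Rightarrow> real) \<Rightarrow> bool" where
  "nonneg_weight p w \<longleftrightarrow>
     (\<forall>n\<ge>1. 0 \<le> w n) \<and> (\<exists>n\<ge>1. 0 < w n) \<and> (\<forall>n\<ge>1. Wp p w n < \<infinity>)"

definition gamma_norm :: "real \<Rightarrow> (nat \<Rightarrow> real) \<Rightarrow> (nat \<Rightarrow> real) \<Rightarrow> ennreal" where
  "gamma_norm p w x =
     epowr (\<Sum>i. epowr (max_rearr x (i + 1)) p * ennreal (w (i + 1))) (1 / p)"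

definition gamma_space :: "real \<Rightarrow> (nat \<Rightarrow> real) \<Rightarrow> (nat \<Rightarrow> real) set" where
  "gamma_space p w = {x \<in> ell0. gamma_norm p w x < \<infinity>}"

text \<open>
  A sequence space is given by its carrier \<open>E\<close> together with a functional \<open>N\<close> on all sequences that
  is finite on \<open>E\<close>.
\<close>

definition order_continuous ::
    "(nat \<Rightarrow> real) set \<Rightarrow> ((nat \<Rightarrow> real) \<Rightarrow> ennreal) \<Rightarrow> bool" where
  "order_continuous E N \<longleftrightarrow>
     (\<forall>x\<in>E. \<forall>xs :: nat \<Rightarrow> nat \<Rightarrow> real.
        (\<forall>m. xs m \<in> E) \<longrightarrow>
        (\<forall>m. \<forall>k\<ge>1. 0 \<le> xs m k \<and> xs m k \<le> \<bar>x k\<bar>) \<longrightarrow>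
        (\<forall>k\<ge>1. (\<lambda>m. xs m k) \<longlonglongrightarrow> 0) \<longrightarrow>
        (\<lambda>m. N (xs m)) \<longlonglongrightarrow> 0)"

end

theory Submission
  imports Defs
begin

text \<open>
  Everything rests on when \<open>x\<^sup>*\<close> tends to \<open>0\<close>, that is, on when the sets \<open>{k. \<bar>x k\<bar> > e}\<close>,
  \<open>e > 0\<close>, are all finite.

  If \<open>W(\<infinity>) = \<infinity>\<close>, this holds for every \<open>x\<close> in the space: if \<open>\<bar>x\<bar>\<close> exceeds \<open>e\<close> infinitely often,
  then \<open>x\<^sup>*\<close>, and hence \<open>x\<^sup>*\<^sup>*\<close>, is at least \<open>e\<close> everywhere, which makes the defining series at
  least \<open>e\<^sup>p W(\<infinity>) = \<infinity>\<close> (lemma \<open>finite_superlevel\<close>). Now let \<open>0 \<le> x\<^sub>m \<le> \<bar>x\<bar>\<close> tend to \<open>0\<close> pointwise.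
  Outside a finite set \<open>x\<^sub>m\<close> is at most \<open>e\<close> because \<open>x\<close> is, and on that finite set pointwise
  convergence is uniform; so \<open>x\<^sub>m\<close> tends to \<open>0\<close> uniformly, and with it \<open>x\<^sub>m\<^sup>*\<^sup>*(n)\<close> for each \<open>n\<close>.
  Since \<open>x\<^sub>m\<^sup>*\<^sup>* \<le> x\<^sup>*\<^sup>*\<close>, dominated convergence for series gives \<open>\<parallel>x\<^sub>m\<parallel> \<rightarrow> 0\<close>.

  If \<open>W(\<infinity>) < \<infinity>\<close>, the constant sequence \<open>1\<close> lies in the space. Its tails, the indicators of
  \<open>{m+1, m+2, \<dots>}\<close>, decrease to \<open>0\<close> pointwise, but a decreasing rearrangement does not notice
  the loss of finitely many of infinitely many equal entries: all tails have the norm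
  \<open>W(\<infinity>)\<^bsup>1/p\<^esup> > 0\<close> (lemma \<open>gamma_norm_tail\<close>).
\<close>

section \<open>Powers of extended nonnegative reals\<close>

lemma epowr_mono: "s \<le> t \<Longrightarrow> 0 \<le> a \<Longrightarrow> epowr s a \<le> epowr t a"
  unfolding epowr_def
  by (auto simp: top_unique enn2real_mono less_top intro!: ennreal_leI powr_mono2)

lemma epowr_ennreal: "0 \<le> c \<Longrightarrow> epowr (ennreal c) a = ennreal (c powr a)"
  by (simp add: epowr_def)

lemma epowr_eq_infinity_iff: "epowr t a = \<infinity> \<longleftrightarrow> t = \<infinity>"
  by (simp add: epowr_def)

lemma epowr_eq_0_iff: "epowr t a = 0 \<longleftrightarrow> t = 0"
  by (cases t) (auto simp: epowr_def ennreal_eq_0_iff)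

lemma ennreal_obtain_real_between:
  assumes "0 < (e :: ennreal)"
  obtains r where "0 < r" "ennreal r < e"
proof -
  obtain s where s: "0 < s" "s < e" using dense[OF assms] by blast
  then have "s < top" using less_trans top.not_eq_extremum by blast
  with s that[of "enn2real s"] show thesis by (simp add: enn2real_positive_iff)
qed

lemma tendsto_epowr_0:
  assumes f: "(f \<longlongrightarrow> 0) F" and a: "0 < a"
  shows "((\<lambda>m. epowr (f m) a) \<longlongrightarrow> 0) F"
proof (rule order_tendstoI)
  fix e :: ennreal assume "0 < e"
  then obtain r where r0: "0 < r" and r: "ennreal r < e" by (rule ennreal_obtain_real_between)
  have "\<forall>\<^sub>F m in F. f m < ennreal (r powr (1 / a))"
    using f by (rule order_tendstoD) (use r0 in simp)
  then show "\<forall>\<^sub>F m in F. epowr (f m) a < e"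
  proof eventually_elim
    case (elim m)
    have "epowr (f m) a \<le> epowr (ennreal (r powr (1 / a))) a"
      using elim a by (intro epowr_mono) auto
    also have "\<dots> = ennreal r"
      using r0 a by (simp add: epowr_ennreal powr_powr)
    finally show ?case using r by simp
  qed
qed simp

section \<open>Rearrangements and their averages\<close>

lemma rearr_mono:
  assumes "\<And>k. k \<ge> 1 \<Longrightarrow> \<bar>y k\<bar> \<le> \<bar>x k\<bar>"
  shows "rearr y n \<le> rearr x n"
proof -
  have "distr y l \<le> distr x l" for l
    unfolding distr_def using assms by (intro emeasure_mono) (auto intro: less_le_trans)
  then show ?thesis
    unfolding rearr_def by (intro Inf_superset_mono) (auto intro: order_trans)
qed

lemma rearr_le_bound:
  assumes "0 \<le> c" "\<And>k. k \<ge> 1 \<Longrightarrow> \<bar>x k\<bar> \<le> c"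
  shows "rearr x n \<le> ennreal c"
proof -
  have "{k \<in> {1..}. \<bar>x k\<bar> > c} = {}" using assms(2) by force
  then have "distr x c = 0" by (simp only: distr_def emeasure_empty)
  then show ?thesis unfolding rearr_def using assms(1) by (intro Inf_lower) auto
qed

text \<open>
  A level below \<open>c\<close> that is exceeded infinitely often is not admissible in the infimum for any \<open>n\<close>.
  The level \<open>c\<close> itself need not be exceeded, so that sequences with supremum \<open>c\<close> are covered.
\<close>
lemma rearr_ge_of_infinite_superlevels:
  assumes "\<And>l. 0 \<le> l \<Longrightarrow> l < c \<Longrightarrow> infinite {k \<in> {1..}. \<bar>x k\<bar> > l}"
  shows "ennreal c \<le> rearr x n"
  unfolding rearr_def
proof (rule Inf_greatest, clarify)
  fix l assume l: "0 \<le> l" "distr x l \<le> of_nat (n - 1)"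
  have "\<not> l < c"
  proof
    assume "l < c"
    with assms l have "infinite {k \<in> {1..}. \<bar>x k\<bar> > l}" by blast
    then have "distr x l = \<infinity>"
      unfolding distr_def by (subst emeasure_count_space_infinite) auto
    with l show False by (simp add: top_unique)
  qed
  then show "ennreal c \<le> ennreal l" by (intro ennreal_leI) simp
qed

lemma average_const_ennreal:
  "1 \<le> n \<Longrightarrow> (\<Sum>i=1..n. c) / of_nat n = (c :: ennreal)"
  by (simp add: mult.commute[of "of_nat n"] ennreal_mult_divide_eq)

lemma max_rearr_mono:
  assumes "\<And>k. k \<ge> 1 \<Longrightarrow> \<bar>y k\<bar> \<le> \<bar>x k\<bar>"
  shows "max_rearr y n \<le> max_rearr x n"
  unfolding max_rearr_def using assms
  by (intro divide_right_mono_ennreal sum_mono rearr_mono)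

lemma max_rearr_le_bound:
  assumes "0 \<le> c" "\<And>k. k \<ge> 1 \<Longrightarrow> \<bar>x k\<bar> \<le> c" "1 \<le> n"
  shows "max_rearr x n \<le> ennreal c"
proof -
  have "max_rearr x n \<le> (\<Sum>i=1..n. ennreal c) / of_nat n"
    unfolding max_rearr_def using assms
    by (intro divide_right_mono_ennreal sum_mono rearr_le_bound)
  then show ?thesis using average_const_ennreal[OF assms(3)] by simp
qed

lemma max_rearr_ge_of_infinite_superlevels:
  assumes "\<And>l. 0 \<le> l \<Longrightarrow> l < c \<Longrightarrow> infinite {k \<in> {1..}. \<bar>x k\<bar> > l}" "1 \<le> n"
  shows "ennreal c \<le> max_rearr x n"
proof -
  have "(\<Sum>i=1..n. ennreal c) / of_nat n \<le> max_rearr x n"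
    unfolding max_rearr_def using assms
    by (intro divide_right_mono_ennreal sum_mono rearr_ge_of_infinite_superlevels)
  then show ?thesis using average_const_ennreal[OF assms(2)] by simp
qed

section \<open>Infinite total weight\<close>

lemma finite_superlevel:
  assumes p: "0 < p" and W: "W_inf w = \<infinity>" and x: "gamma_norm p w x < \<infinity>" and e: "0 < e"
  shows "finite {k \<in> {1..}. \<bar>x k\<bar> > e}"
proof (rule ccontr)
  assume inf: "infinite {k \<in> {1..}. \<bar>x k\<bar> > e}"
  have "infinite {k \<in> {1..}. \<bar>x k\<bar> > l}" if "l < e" for l
    using inf by (rule contrapos_nn) (use that in \<open>auto elim!: rev_finite_subset\<close>)
  then have ge: "ennreal e \<le> max_rearr x (i + 1)" for i
    by (intro max_rearr_ge_of_infinite_superlevels) auto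
  have "\<infinity> = ennreal (e powr p) * W_inf w"
    using W e by (simp add: ennreal_mult_top)
  also have "\<dots> = (\<Sum>i. ennreal (e powr p) * ennreal (w (i + 1)))"
    unfolding W_inf_def by simp
  also have "\<dots> \<le> (\<Sum>i. epowr (max_rearr x (i + 1)) p * ennreal (w (i + 1)))"
    using ge p e
    by (intro suminf_le mult_right_mono) (auto simp flip: epowr_ennreal intro!: epowr_mono)
  finally have "(\<Sum>i. epowr (max_rearr x (i + 1)) p * ennreal (w (i + 1))) = \<infinity>"
    by (simp add: top_unique)
  then have "gamma_norm p w x = \<infinity>"
    unfolding gamma_norm_def by (simp add: epowr_def)
  with x show False by simp
qed

text \<open>
  Domination by a sequence with finite superlevel sets upgrades pointwise to uniform convergence,
  which is what controls the rearrangements.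
\<close>
lemma max_rearr_tendsto_0:
  assumes fin: "\<And>e. 0 < e \<Longrightarrow> finite {k \<in> {1..}. \<bar>x k\<bar> > e}"
    and dom: "\<And>m k. k \<ge> 1 \<Longrightarrow> \<bar>xs m k\<bar> \<le> \<bar>x k\<bar>"
    and lim: "\<And>k. k \<ge> 1 \<Longrightarrow> (\<lambda>m. xs m k) \<longlonglongrightarrow> 0"
    and n: "1 \<le> n"
  shows "(\<lambda>m. max_rearr (xs m) n) \<longlonglongrightarrow> 0"
proof (rule order_tendstoI)
  fix e :: ennreal assume "0 < e"
  then obtain r where r0: "0 < r" and r: "ennreal r < e" by (rule ennreal_obtain_real_between)
  have "\<forall>\<^sub>F m in sequentially. \<forall>k\<in>{k \<in> {1..}. \<bar>x k\<bar> > r}. \<bar>xs m k\<bar> < r"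
  proof (intro eventually_ball_finite fin r0 ballI)
    fix k assume "k \<in> {k \<in> {1..}. \<bar>x k\<bar> > r}"
    then have "(\<lambda>m. \<bar>xs m k\<bar>) \<longlonglongrightarrow> 0" using lim by (intro tendsto_rabs_zero) auto
    then show "\<forall>\<^sub>F m in sequentially. \<bar>xs m k\<bar> < r" using r0 by (rule order_tendstoD)
  qed
  then show "\<forall>\<^sub>F m in sequentially. max_rearr (xs m) n < e"
  proof eventually_elim
    case (elim m)
    have "\<bar>xs m k\<bar> \<le> r" if "k \<ge> 1" for k
      using elim dom[OF that, of m] that by (cases "\<bar>x k\<bar> > r") force+
    then have "max_rearr (xs m) n \<le> ennreal r" using r0 n by (intro max_rearr_le_bound) auto
    with r show ?case by simp
  qed
qed simp

lemma suminf_ennreal_dominated_tendsto_0: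
  fixes f :: "nat \<Rightarrow> nat \<Rightarrow> ennreal"
  assumes "\<And>m i. f m i \<le> g i" "(\<Sum>i. g i) < \<infinity>" "\<And>i. (\<lambda>m. f m i) \<longlonglongrightarrow> 0"
  shows "(\<lambda>m. \<Sum>i. f m i) \<longlonglongrightarrow> 0"
proof -
  have "(\<lambda>m. \<integral>\<^sup>+ i. f m i \<partial>count_space UNIV) \<longlonglongrightarrow> (\<integral>\<^sup>+ i. 0 \<partial>count_space (UNIV :: nat set))"
    using assms
    by (intro nn_integral_dominated_convergence[where w = g]) (auto simp: nn_integral_count_space_nat)
  then show ?thesis by (simp add: nn_integral_count_space_nat)
qed

lemma order_continuous_gamma_space:
  assumes p: "0 < p" and W: "W_inf w = \<infinity>"
  shows "order_continuous (gamma_space p w) (gamma_norm p w)"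
  unfolding order_continuous_def
proof (intro ballI allI impI)
  fix x and xs :: "nat \<Rightarrow> nat \<Rightarrow> real"
  assume "x \<in> gamma_space p w"
    and bounds: "\<forall>m. \<forall>k\<ge>1. 0 \<le> xs m k \<and> xs m k \<le> \<bar>x k\<bar>"
    and lim: "\<forall>k\<ge>1. (\<lambda>m. xs m k) \<longlonglongrightarrow> 0"
  then have x: "gamma_norm p w x < \<infinity>" by (simp add: gamma_space_def)
  have dom: "\<bar>xs m k\<bar> \<le> \<bar>x k\<bar>" if "k \<ge> 1" for m k using bounds that by simp
  have "(\<lambda>m. \<Sum>i. epowr (max_rearr (xs m) (i + 1)) p * ennreal (w (i + 1))) \<longlonglongrightarrow> 0"
  proof (rule suminf_ennreal_dominated_tendsto_0)
    show "epowr (max_rearr (xs m) (i + 1)) p * ennreal (w (i + 1))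
        \<le> epowr (max_rearr x (i + 1)) p * ennreal (w (i + 1))" for m i
      using p dom by (intro mult_right_mono epowr_mono max_rearr_mono) auto
    show "(\<Sum>i. epowr (max_rearr x (i + 1)) p * ennreal (w (i + 1))) < \<infinity>"
      using x unfolding gamma_norm_def by
        (simp add: epowr_eq_infinity_iff[simplified] less_top[symmetric])
    show "(\<lambda>m. epowr (max_rearr (xs m) (i + 1)) p * ennreal (w (i + 1))) \<longlonglongrightarrow> 0" for i
    proof -
      have "(\<lambda>m. max_rearr (xs m) (i + 1)) \<longlonglongrightarrow> 0"
        using finite_superlevel[OF p W x] dom lim by (intro max_rearr_tendsto_0[where x = x]) auto
      from ennreal_tendsto_cmult[OF _ tendsto_epowr_0[OF this p], of "ennreal (w (i + 1))"]
      show ?thesis by (simp add: mult.commute)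
    qed
  qed
  then show "(\<lambda>m. gamma_norm p w (xs m)) \<longlonglongrightarrow> 0"
    unfolding gamma_norm_def using p by (intro tendsto_epowr_0) auto
qed

section \<open>Finite total weight\<close>

lemma gamma_norm_tail:
  "gamma_norm p w (\<lambda>k. if m < k then 1 else 0) = epowr (W_inf w) (1 / p)"
proof -
  let ?x = "\<lambda>k. if m < k then 1 else 0 :: real"
  have "infinite {k \<in> {1..}. \<bar>?x k\<bar> > l}" if "l < 1" for l
  proof (rule infinite_super)
    show "{Suc m..} \<subseteq> {k \<in> {1..}. \<bar>?x k\<bar> > l}" using that by auto
  qed (rule infinite_Ici)
  then have "max_rearr ?x (i + 1) = ennreal 1" for i
    by (intro antisym max_rearr_le_bound max_rearr_ge_of_infinite_superlevels) auto
  then show ?thesis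
    by (simp add: gamma_norm_def W_inf_def epowr_ennreal[of 1, simplified])
qed

lemma not_order_continuous_gamma_space:
  assumes W: "0 < W_inf w" "W_inf w < \<infinity>"
  shows "\<not> order_continuous (gamma_space p w) (gamma_norm p w)"
proof
  assume oc: "order_continuous (gamma_space p w) (gamma_norm p w)"
  let ?t = "\<lambda>m k. if m < k then 1 else 0 :: real"
  have mem: "?t m \<in> gamma_space p w" for m
    using W by (auto simp: gamma_space_def ell0_def gamma_norm_tail epowr_def)
  have lim: "(\<lambda>m. ?t m k) \<longlonglongrightarrow> 0" for k
    by (rule tendsto_eventually, rule eventually_mono[OF eventually_ge_at_top[of k]]) auto
  \<comment> \<open>The tail from \<open>0\<close> on is the constant sequence \<open>1\<close> on the positive integers.\<close>
  have "(\<lambda>m. gamma_norm p w (?t m)) \<longlonglongrightarrow> 0"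
    using oc[unfolded order_continuous_def, rule_format, of "?t 0" ?t] mem lim by simp
  then have "epowr (W_inf w) (1 / p) = 0"
    by (simp add: gamma_norm_tail LIMSEQ_const_iff)
  with W show False by (simp add: epowr_eq_0_iff)
qed

lemma W_inf_pos:
  assumes "nonneg_weight p w"
  shows "0 < W_inf w"
proof -
  obtain n where n: "n \<ge> 1" "0 < w n" using assms by (auto simp: nonneg_weight_def)
  have "ennreal (w (n - 1 + 1)) \<le> W_inf w"
    unfolding W_inf_def using sum_le_suminf[of "\<lambda>i. ennreal (w (i + 1))" "{n - 1}"] by simp
  moreover have "0 < ennreal (w (n - 1 + 1))" using n by simp
  ultimately show ?thesis by (rule less_le_trans[rotated])
qed

theorem theorem4p1:
  fixes w :: "nat \<Rightarrow> real" and p :: real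
  assumes "0 < p" and "nonneg_weight p w"
  shows "order_continuous (gamma_space p w) (gamma_norm p w) \<longleftrightarrow> W_inf w = \<infinity>"
  using order_continuous_gamma_space[OF assms(1)]
    not_order_continuous_gamma_space[OF W_inf_pos[OF assms(2)]]
  by (metis infinity_ennreal_def top.not_eq_extremum)

end
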